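(* Consider one synchronous TriDE sweep with sharpness $\beta>0$ on the viewing graph $(V,E)$, with true unoriented directions $g_e^\star$, current directions $g_e^{(0)}$, current point supports $A_e^{(0)}$, retained witness sets $\mathcal N_{ij}$, candidate pools $\mathcal C_{ij}$ and output directions $g_{ij}^+$, all as defined in the context. Let $R\subseteq E$ be a set of clean anchor edges, and for $ij\in E$ put $$\mathcal G_{ij}=\{k\in\mathcal N_{ij}: ik\in R,\ jk\in R\},\qquad \mathcal B_{ij}=\mathcal N_{ij}\setminus\mathcal G_{ij}.$$ Let $a\in(0,1]$, $c_{\rm wd}>0$, $\Delta>0$, $\eta>0$, and assume the following. (D1) For every $e\in R$, $g_e^{(0)}=\pm g_e^\star$. (D2) For every $ij\in E$, $|\mathcal G_{ij}|\ge a|\mathcal N_{ij}|$ and $\mathcal G_{ij}\neq\varnothing$. (D3) For every $ij\in E$, $$\frac1{|\mathcal G_{ij}|}\sum_{k\in\mathcal G_{ij}}|h^\top n_{ij,k}^\star|\ \ge\ c_{\rm wd}\,\|P_{(g_{ij}^\star)^\perp}h\|_2\qquad\text{for all }h\in\mathbb R^3 .$$ (D4) For every $ij\in E$, $$\min_{k\in\mathcal G_{ij}}H_{ij,k}-\max_{k\in\mathcal B_{ij}}H_{ij,k}\ \ge\ \Delta ,$$ where the maximum over an empty $\mathcal B_{ij}$ is interpreted as $-\infty$. (D5) For every $ij\in E$, the finite pool $\mathcal C_{ij}$ contains the true unoriented direction $\pm g_{ij}^\star$, and every $c\in\mathcal C_{ij}\setminus\{\pm g_{ij}^\star\}$ satisfies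 $\operatorname{err}(c,g_{ij}^\star)\ge\eta$. Then $$\max_{ij\in E}\operatorname{err}(g_{ij}^+,g_{ij}^\star)\ \le\ \frac{1-a}{a\,c_{\rm wd}}\,e^{-\beta\Delta}.$$ Consequently, if $\frac{1-a}{a\,c_{\rm wd}}e^{-\beta\Delta}<\eta$, then $g_{ij}^+=\pm g_{ij}^\star$ for all $ij\in E$. Equivalently, for this exact recovery it is sufficient that $$\beta>\frac1\Delta\log\!\left(\frac{1-a}{a\,c_{\rm wd}\,\eta}\right),$$ with the convention that this condition is vacuous if $(1-a)/(a\,c_{\rm wd}\,\eta)\le 1$.
   Context: Setting. $(V,E)$ is a finite simple graph whose vertices are cameras with distinct locations $t_i\in\mathbb R^3$. For an edge $e=ij$, the true unoriented direction $g_e^\star=g_{ij}^\star\in\mathbb S^2/\{\pm1\}$ is represented by the unit vector $(t_i-t_j)/\|t_i-t_j\|_2$ (sign immaterial). For a unit vector $c$, $\operatorname{err}(c,g_e^\star)=\|P_{(g_e^\star)^\perp}c\|_2=\sqrt{1-(c^\top g_e^\star)^2}$, where $P_W$ denotes orthogonal projection onto $W$. State before the sweep. Each edge $e$ has a current direction $g_e^{(0)}\in\mathbb S^2$ and correspondence normals $x_{e,1},\dots,x_{e,N_e}\in\mathbb S^2$. With $\sigma_0=\pi/180$, the point support is $$A_e(g)=\frac1{N_e}\sum_{r=1}^{N_e}\exp\!\Big(-\frac{\arcsin^2(|g^\top x_{e,r}|)}{2\sigma_0^2}\Big),\qquad A_e^{(0)}=A_e(g_e^{(0)}).$$ Witnesses.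 For each $ij\in E$, $\mathcal N_{ij}$ is the set of retained witnesses $k$: $k\in\mathcal N_{ij}$ only if $ik,jk\in E$ and $g_{ik}^{(0)}\times g_{jk}^{(0)}$ passes a nondegeneracy test (in particular is nonzero). For $k\in\mathcal N_{ij}$ put $\widehat n_{ij,k}=\frac{g_{ik}^{(0)}\times g_{jk}^{(0)}}{\|g_{ik}^{(0)}\times g_{jk}^{(0)}\|_2}$ and $H_{ij,k}=A_{ik}^{(0)}+A_{jk}^{(0)}$. For a nondegenerate true camera triangle, $n_{ij,k}^\star=\frac{g_{ik}^\star\times g_{jk}^\star}{\|g_{ik}^\star\times g_{jk}^\star\|_2}$ (defined up to sign). Sweep. The weights are $w_{ij,k}=e^{\beta H_{ij,k}}/\sum_{\ell\in\mathcal N_{ij}}e^{\beta H_{ij,\ell}}$. Each edge has a finite candidate pool $\mathcal C_{ij}\subset\mathbb S^2$ (candidates regarded up to sign). The output of one synchronous sweep is, simultaneously for all $ij\in E$, any $$g_{ij}^+\in\arg\min_{c\in\mathcal C_{ij}}\ \sum_{k\in\mathcal N_{ij}}w_{ij,k}\,|c^\top\widehat n_{ij,k}| .$$ *)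

theory Defs
  imports "HOL-Analysis.Analysis"
begin

text \<open>
  A finite simple graph is given by its vertex set and its set of edges, an edge being the
  two-element set of its ends.  Data attached to edges are functions on such sets, so that
  \<open>f {i, j} = f {j, i}\<close> by construction.
\<close>

definition finite_simple_graph :: "'v set \<Rightarrow> 'v set set \<Rightarrow> bool" where
  "finite_simple_graph V E \<longleftrightarrow> finite V \<and> (\<forall>e\<in>E. e \<subseteq> V \<and> card e = 2)"

definition orth_proj :: "'a::euclidean_space set \<Rightarrow> 'a \<Rightarrow> 'a" where
  "orth_proj W x = (THE p. p \<in> W \<and> x - p \<in> W\<^sup>\<bottom>)"

text \<open>An element of the sphere modulo sign is handled through its unit representatives.\<close>

definition same_dir :: "real ^ 3 \<Rightarrow> real ^ 3 \<Rightarrow> bool" where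
  "same_dir u v \<longleftrightarrow> u = v \<or> u = - v"

definition true_dir :: "('v \<Rightarrow> real ^ 3) \<Rightarrow> 'v \<Rightarrow> 'v \<Rightarrow> real ^ 3" where
  "true_dir t i j = (t i - t j) /\<^sub>R norm (t i - t j)"

definition err :: "real ^ 3 \<Rightarrow> real ^ 3 \<Rightarrow> real" where
  "err c g = norm (orth_proj ({g}\<^sup>\<bottom>) c)"

definition sigma0 :: real where
  "sigma0 = pi / 180"

text \<open>Edge \<open>e\<close> carries the correspondence normals \<open>x e 1, \<dots>, x e (N e)\<close>.\<close>

definition point_support ::
  "('v set \<Rightarrow> nat) \<Rightarrow> ('v set \<Rightarrow> nat \<Rightarrow> real ^ 3) \<Rightarrow> 'v set \<Rightarrow> real ^ 3 \<Rightarrow> real" where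
  "point_support N x e g =
     1 / real (N e) * (\<Sum>r = 1..N e. exp (- ((arcsin \<bar>g \<bullet> x e r\<bar>)\<^sup>2 / (2 * sigma0\<^sup>2))))"

definition unit_normal :: "real ^ 3 \<Rightarrow> real ^ 3 \<Rightarrow> real ^ 3" where
  "unit_normal u v = cross3 u v /\<^sub>R norm (cross3 u v)"

text \<open>
  The two normals below change sign when \<open>i\<close> and \<open>j\<close> are exchanged; they are only used inside
  absolute values.
\<close>

definition witness_normal :: "('v set \<Rightarrow> real ^ 3) \<Rightarrow> 'v \<Rightarrow> 'v \<Rightarrow> 'v \<Rightarrow> real ^ 3" where
  "witness_normal g i j k = unit_normal (g {i, k}) (g {j, k})"

definition true_normal :: "('v \<Rightarrow> real ^ 3) \<Rightarrow> 'v \<Rightarrow> 'v \<Rightarrow> 'v \<Rightarrow> real ^ 3" where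
  "true_normal t i j k = unit_normal (true_dir t i k) (true_dir t j k)"

text \<open>In the next definitions \<open>A\<close> gives the current point support of each edge,
  \<open>W\<close> the retained witnesses of each edge.\<close>

definition witness_support :: "('v set \<Rightarrow> real) \<Rightarrow> 'v \<Rightarrow> 'v \<Rightarrow> 'v \<Rightarrow> real" where
  "witness_support A i j k = A {i, k} + A {j, k}"

definition witness_weight ::
  "real \<Rightarrow> ('v set \<Rightarrow> real) \<Rightarrow> ('v set \<Rightarrow> 'v set) \<Rightarrow> 'v \<Rightarrow> 'v \<Rightarrow> 'v \<Rightarrow> real" where
  "witness_weight \<beta> A W i j k =
     exp (\<beta> * witness_support A i j k) /
     (\<Sum>l\<in>W {i, j}. exp (\<beta> * witness_support A i j l))"

definition sweep_loss ::
  "real \<Rightarrow> ('v set \<Rightarrow> real) \<Rightarrow> ('v set \<Rightarrow> real ^ 3) \<Rightarrow> ('v set \<Rightarrow> 'v set)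
    \<Rightarrow> 'v \<Rightarrow> 'v \<Rightarrow> real ^ 3 \<Rightarrow> real" where
  "sweep_loss \<beta> A g W i j c =
     (\<Sum>k\<in>W {i, j}. witness_weight \<beta> A W i j k * \<bar>c \<bullet> witness_normal g i j k\<bar>)"

definition good_witnesses :: "('v set \<Rightarrow> 'v set) \<Rightarrow> 'v set set \<Rightarrow> 'v \<Rightarrow> 'v \<Rightarrow> 'v set" where
  "good_witnesses W R i j = {k \<in> W {i, j}. {i, k} \<in> R \<and> {j, k} \<in> R}"

definition bad_witnesses :: "('v set \<Rightarrow> 'v set) \<Rightarrow> 'v set set \<Rightarrow> 'v \<Rightarrow> 'v \<Rightarrow> 'v set" where
  "bad_witnesses W R i j = W {i, j} - good_witnesses W R i j"


lemma orth_proj_hyperplane: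
  assumes "norm g = 1"
  shows "orth_proj ({g}\<^sup>\<bottom>) x = x - (x \<bullet> g) *\<^sub>R g"
  unfolding orth_proj_def
proof (rule the_equality)
  have gg: "g \<bullet> g = 1"
    using assms by (simp add: dot_square_norm)
  show "x - (x \<bullet> g) *\<^sub>R g \<in> {g}\<^sup>\<bottom> \<and> x - (x - (x \<bullet> g) *\<^sub>R g) \<in> {g}\<^sup>\<bottom>\<^sup>\<bottom>"
    by (auto simp: orthogonal_comp_def orthogonal_def inner_diff_right inner_commute gg)
  fix p assume p: "p \<in> {g}\<^sup>\<bottom> \<and> x - p \<in> {g}\<^sup>\<bottom>\<^sup>\<bottom>"
  define d where "d = x - (x \<bullet> g) *\<^sub>R g - p"
  have "g \<bullet> p = 0"
    using p by (auto simp: orthogonal_comp_def orthogonal_def)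
  then have gd: "g \<bullet> d = 0"
    by (simp add: d_def inner_diff_right inner_commute gg)
  then have "d \<in> {g}\<^sup>\<bottom>"
    by (simp add: orthogonal_comp_def orthogonal_def)
  then have "d \<bullet> (x - p) = 0"
    using p by (auto simp: orthogonal_comp_def orthogonal_def)
  moreover have "d \<bullet> (x - p) = d \<bullet> d + (x \<bullet> g) * (g \<bullet> d)"
    by (simp add: d_def algebra_simps inner_commute)
  ultimately have "d = 0"
    using gd by simp
  then show "p = x - (x \<bullet> g) *\<^sub>R g"
    by (simp add: d_def)
qed

lemma err_eq:
  assumes "norm c = 1" "norm g = 1"
  shows "err c g = sqrt (1 - (c \<bullet> g)\<^sup>2)"
proof -
  have "c \<bullet> c = 1" "g \<bullet> g = 1"
    using assms by (simp_all add: dot_square_norm)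
  then show ?thesis
    unfolding err_def orth_proj_hyperplane[OF assms(2)] norm_eq_sqrt_inner
    by (simp add: algebra_simps inner_commute power2_eq_square)
qed

lemma sweep_loss_commute: "sweep_loss \<beta> A g W i j c = sweep_loss \<beta> A g W j i c"
proof -
  have n: "witness_normal g i j k = - witness_normal g j i k" for k
    by (subst (1 2) witness_normal_def, subst (1 2) unit_normal_def,
        subst (1 2) cross_skew) simp
  have s: "witness_support A i j = witness_support A j i"
    by (simp add: fun_eq_iff witness_support_def add.commute)
  show ?thesis
    unfolding sweep_loss_def witness_weight_def s
    by (simp add: n insert_commute)
qed

end

(* The normal of a camera triangle is orthogonal to its edges, so a good witness has zero loss at
   the true direction and the loss there comes from bad witnesses alone.
   Each bad weight is at most exp (- \<beta> * \<Delta>) times each good weight.  Comparing the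
   loss at the minimiser, whose good part is bounded below by the well-distribution condition, with
   the loss at the true direction gives the bound; the normalisation of the weights cancels. *)
theory Submission
  imports Defs
begin

text \<open>The vector \<open>t i - t j\<close> is the difference of \<open>t i - t k\<close> and
  \<open>t j - t k\<close>, and a cross product is orthogonal to both its factors. For a degenerate
  triangle the normal is 0 because \<open>inverse 0 = 0\<close>.\<close>

lemma true_dir_orthogonal_true_normal: "true_dir t i j \<bullet> true_normal t i j k = 0"
proof -
  let ?n = "cross3 (t i - t k) (t j - t k)"
  have "(t i - t j) \<bullet> ?n = (t i - t k) \<bullet> ?n - (t j - t k) \<bullet> ?n"
    by (simp flip: inner_diff_left)
  then have "(t i - t j) \<bullet> ?n = 0"
    by (simp only: dot_cross_self)
  then show ?thesis
    by (simp add: true_dir_def true_normal_def unit_normal_def cross_mult_left cross_mult_right)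
qed

lemma same_dir_abs_inner: "same_dir u v \<Longrightarrow> \<bar>c \<bullet> u\<bar> = \<bar>c \<bullet> v\<bar>"
  by (auto simp: same_dir_def)

text \<open>Unit normals are thus well defined on directions modulo sign, which is all that anchors
  determine.\<close>

lemma same_dir_unit_normal:
  assumes "same_dir u u'" "same_dir v v'"
  shows "same_dir (unit_normal u v) (unit_normal u' v')"
  using assms by (auto simp: same_dir_def unit_normal_def cross_minus_left cross_minus_right)

text \<open>An inequality, since parallel factors give the zero vector.\<close>

lemma norm_unit_normal_le: "norm (unit_normal u v) \<le> 1"
  by (cases "cross3 u v = 0") (simp_all add: unit_normal_def)

text \<open>The denominator does not depend on \<open>c\<close>, so candidates can be compared by
  their unnormalised losses.\<close>

lemma sweep_loss_eq:
  "sweep_loss \<beta> A g W i j c =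
     (\<Sum>k\<in>W {i, j}. exp (\<beta> * witness_support A i j k) * \<bar>c \<bullet> witness_normal g i j k\<bar>) /
     (\<Sum>l\<in>W {i, j}. exp (\<beta> * witness_support A i j l))"
  by (simp add: sweep_loss_def witness_weight_def sum_divide_distrib)

text \<open>The comparison without its geometry: \<open>p\<close> and \<open>q\<close> stand for the
  residuals at the minimiser and at the true direction, \<open>H\<close> for the witness supports,
  \<open>\<epsilon>\<close> for the error of the minimiser.\<close>

lemma softmax_comparison_bound:
  fixes H p q :: "'a \<Rightarrow> real"
  assumes fin: "finite W" and G: "G \<subseteq> W" "G \<noteq> {}"
    and frac: "a * real (card W) \<le> real (card G)"
    and pos: "0 < a" "a \<le> 1" "0 < c" "0 \<le> \<beta>"
    and gap: "\<And>k l. k \<in> G \<Longrightarrow> l \<in> W - G \<Longrightarrow> \<Delta> \<le> H k - H l"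
    and sharp: "c * \<epsilon> \<le> 1 / real (card G) * (\<Sum>k\<in>G. p k)"
    and p: "\<And>k. k \<in> W \<Longrightarrow> 0 \<le> p k"
    and qG: "\<And>k. k \<in> G \<Longrightarrow> q k = 0" and qB: "\<And>k. k \<in> W - G \<Longrightarrow> q k \<le> 1"
    and le: "(\<Sum>k\<in>W. exp (\<beta> * H k) * p k) \<le> (\<Sum>k\<in>W. exp (\<beta> * H k) * q k)"
  shows "\<epsilon> \<le> (1 - a) / (a * c) * exp (- \<beta> * \<Delta>)"
proof -
  have finG: "finite G"
    using G fin finite_subset by blast
  \<comment> \<open>The least good score is the reference level: good weights are at least
    \<open>exp (\<beta> * m)\<close>, bad ones at most
    \<open>exp (\<beta> * (m - \<Delta>))\<close>, so the factor \<open>exp (\<beta> * m)\<close>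
    cancels.\<close>
  define m where "m = Min (H ` G)"
  have m_in: "m \<in> H ` G"
    unfolding m_def using finG G by (intro Min_in) auto
  have m_le: "m \<le> H k" if "k \<in> G" for k
    unfolding m_def using finG that by simp
  have "exp (\<beta> * m) * (\<Sum>k\<in>G. p k) = (\<Sum>k\<in>G. exp (\<beta> * m) * p k)"
    by (simp add: sum_distrib_left)
  also have "\<dots> \<le> (\<Sum>k\<in>G. exp (\<beta> * H k) * p k)"
    using m_le p G pos by (intro sum_mono mult_right_mono) (auto simp: mult_left_mono)
  also have "\<dots> \<le> (\<Sum>k\<in>W. exp (\<beta> * H k) * p k)"
    using G fin p by (intro sum_mono2) auto
  also have "\<dots> \<le> (\<Sum>k\<in>W. exp (\<beta> * H k) * q k)"
    by (fact le)
  also have "\<dots> = (\<Sum>k\<in>W - G. exp (\<beta> * H k) * q k)"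
    using fin qG by (intro sum.mono_neutral_right) auto
  also have "\<dots> \<le> (\<Sum>k\<in>W - G. exp (\<beta> * (m - \<Delta>)))"
  proof (rule sum_mono)
    fix l assume l: "l \<in> W - G"
    \<comment> \<open>The minimum is attained at a good witness, to which \<open>gap\<close>
      applies.\<close>
    have "H l \<le> m - \<Delta>"
      using m_in gap l by fastforce
    then have "exp (\<beta> * H l) \<le> exp (\<beta> * (m - \<Delta>))"
      using pos by (simp add: mult_left_mono)
    moreover have "exp (\<beta> * H l) * q l \<le> exp (\<beta> * H l)"
      using qB[OF l] by simp
    ultimately show "exp (\<beta> * H l) * q l \<le> exp (\<beta> * (m - \<Delta>))"
      by linarith
  qed
  also have "\<dots> = exp (\<beta> * m) * (real (card (W - G)) * exp (- \<beta> * \<Delta>))"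
    using exp_add[of "\<beta> * m" "- \<beta> * \<Delta>"] by (simp add: right_diff_distrib)
  finally have sum_le: "(\<Sum>k\<in>G. p k) \<le> real (card (W - G)) * exp (- \<beta> * \<Delta>)"
    by simp
  have cG: "0 < real (card G)"
    using finG G by (simp add: card_gt_0_iff)
  \<comment> \<open>Splitting W into good and bad turns the lower bound on the good fraction into a
    bound on the ratio of bad to good, the source of \<open>(1 - a) / a\<close>.\<close>
  have "real (card W) = real (card G) + real (card (W - G))"
    using G fin finG by (simp add: card_Diff_subset card_mono)
  then have "a * real (card (W - G)) \<le> (1 - a) * real (card G)"
    using frac by (simp only:) (simp add: algebra_simps)
  then have cB: "real (card (W - G)) / real (card G) \<le> (1 - a) / a"
    using cG pos by (simp add: field_simps)
  have "c * \<epsilon> \<le> real (card (W - G)) / real (card G) * exp (- \<beta> * \<Delta>)"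
    using sharp sum_le cG by (simp add: field_simps)
  also have "\<dots> \<le> (1 - a) / a * exp (- \<beta> * \<Delta>)"
    using cB by (intro mult_right_mono) auto
  finally show ?thesis
    using pos by (simp add: field_simps)
qed

text \<open>If \<open>b \<le> \<eta>\<close>, the exponential factor below 1 already suffices;
  otherwise take logarithms. The case split ensures that \<open>ln\<close> matters only at arguments
  above 1, so its value at 0 never enters.\<close>

lemma sharpness_threshold:
  fixes b \<eta> \<Delta> \<beta> :: real
  assumes "0 \<le> b" "0 < \<eta>" "0 < \<Delta>" "0 < \<beta>"
  shows "b * exp (- \<beta> * \<Delta>) < \<eta> \<longleftrightarrow> b / \<eta> \<le> 1 \<or> 1 / \<Delta> * ln (b / \<eta>) < \<beta>"
proof (cases "b / \<eta> \<le> 1")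
  case True
  then have "b \<le> \<eta>"
    using assms by simp
  moreover have "exp (- \<beta> * \<Delta>) < 1"
    using assms by simp
  ultimately have "b * exp (- \<beta> * \<Delta>) < \<eta>"
    \<comment> \<open>For \<open>b = 0\<close> strictness comes from \<open>0 < \<eta>\<close>,
      otherwise from the exponential factor.\<close>
    using assms by (cases "b = 0") (auto intro: less_le_trans[of _ "b * 1"])
  with True show ?thesis
    by simp
next
  case False
  then have "0 < b / \<eta>"
    by simp
  have "1 / \<Delta> * ln (b / \<eta>) < \<beta> \<longleftrightarrow> ln (b / \<eta>) < \<beta> * \<Delta>"
    using assms by (simp add: pos_divide_less_eq)
  also have "\<dots> \<longleftrightarrow> b / \<eta> < exp (\<beta> * \<Delta>)"
    using \<open>0 < b / \<eta>\<close> by (metis exp_less_cancel_iff exp_ln)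
  also have "\<dots> \<longleftrightarrow> b * exp (- \<beta> * \<Delta>) < \<eta>"
    using assms by (simp add: exp_minus field_simps)
  finally show ?thesis
    using False by simp
qed

theorem theoremH6:
  fixes V :: "'v set" and E :: "'v set set" and t :: "'v \<Rightarrow> real ^ 3"
    and g0 :: "'v set \<Rightarrow> real ^ 3"
    and N :: "'v set \<Rightarrow> nat" and x :: "'v set \<Rightarrow> nat \<Rightarrow> real ^ 3"
    and A0 :: "'v set \<Rightarrow> real"
    and W :: "'v set \<Rightarrow> 'v set" and C :: "'v set \<Rightarrow> (real ^ 3) set"
    and gplus :: "'v set \<Rightarrow> real ^ 3"
    and R :: "'v set set"
    and \<beta> a c\<^sub>w\<^sub>d \<Delta> \<eta> :: real
  assumes graph: "finite_simple_graph V E"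
    and locations: "inj_on t V"
    and current: "\<And>e. e \<in> E \<Longrightarrow> g0 e \<in> sphere 0 1"
    and normals: "\<And>e. e \<in> E \<Longrightarrow> N e \<ge> 1 \<and> (\<forall>r\<in>{1..N e}. x e r \<in> sphere 0 1)"
    and support: "\<And>e. e \<in> E \<Longrightarrow> A0 e = point_support N x e (g0 e)"
    and witnesses: "\<And>i j k. {i, j} \<in> E \<Longrightarrow> k \<in> W {i, j} \<Longrightarrow>
          {i, k} \<in> E \<and> {j, k} \<in> E \<and> cross3 (g0 {i, k}) (g0 {j, k}) \<noteq> 0"
    and pools: "\<And>e. e \<in> E \<Longrightarrow> finite (C e) \<and> C e \<subseteq> sphere 0 1"
    and sharpness: "\<beta> > 0"
    and sweep: "\<And>i j. {i, j} \<in> E \<Longrightarrow>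
          is_arg_min (sweep_loss \<beta> A0 g0 W i j) (\<lambda>c. c \<in> C {i, j}) (gplus {i, j})"
    and anchors: "R \<subseteq> E"
    and params: "0 < a" "a \<le> 1" "c\<^sub>w\<^sub>d > 0" "\<Delta> > 0" "\<eta> > 0"
    and D1: "\<And>i j. {i, j} \<in> R \<Longrightarrow> same_dir (g0 {i, j}) (true_dir t i j)"
    and D2: "\<And>i j. {i, j} \<in> E \<Longrightarrow>
          real (card (good_witnesses W R i j)) \<ge> a * real (card (W {i, j})) \<and>
          good_witnesses W R i j \<noteq> {}"
    and D3: "\<And>i j h. {i, j} \<in> E \<Longrightarrow>
          1 / real (card (good_witnesses W R i j)) *
            (\<Sum>k\<in>good_witnesses W R i j. \<bar>h \<bullet> true_normal t i j k\<bar>)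
          \<ge> c\<^sub>w\<^sub>d * norm (orth_proj ({true_dir t i j}\<^sup>\<bottom>) h)"
    and D4: "\<And>i j. {i, j} \<in> E \<Longrightarrow> bad_witnesses W R i j \<noteq> {} \<Longrightarrow>
          Min (witness_support A0 i j ` good_witnesses W R i j)
          - Max (witness_support A0 i j ` bad_witnesses W R i j) \<ge> \<Delta>"
    and D5: "\<And>i j. {i, j} \<in> E \<Longrightarrow>
          (\<exists>c\<in>C {i, j}. same_dir c (true_dir t i j)) \<and>
          (\<forall>c\<in>C {i, j}. \<not> same_dir c (true_dir t i j) \<longrightarrow> err c (true_dir t i j) \<ge> \<eta>)"
  shows "(\<forall>i j. {i, j} \<in> E \<longrightarrow>
            err (gplus {i, j}) (true_dir t i j) \<le> (1 - a) / (a * c\<^sub>w\<^sub>d) * exp (- \<beta> * \<Delta>))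
       \<and> ((1 - a) / (a * c\<^sub>w\<^sub>d) * exp (- \<beta> * \<Delta>) < \<eta> \<longrightarrow>
            (\<forall>i j. {i, j} \<in> E \<longrightarrow> same_dir (gplus {i, j}) (true_dir t i j)))
       \<and> ((1 - a) / (a * c\<^sub>w\<^sub>d) * exp (- \<beta> * \<Delta>) < \<eta> \<longleftrightarrow>
            (1 - a) / (a * c\<^sub>w\<^sub>d * \<eta>) \<le> 1 \<or>
            \<beta> > 1 / \<Delta> * ln ((1 - a) / (a * c\<^sub>w\<^sub>d * \<eta>)))
       \<and> ((1 - a) / (a * c\<^sub>w\<^sub>d * \<eta>) \<le> 1 \<or>
            \<beta> > 1 / \<Delta> * ln ((1 - a) / (a * c\<^sub>w\<^sub>d * \<eta>)) \<longrightarrow>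
            (\<forall>i j. {i, j} \<in> E \<longrightarrow> same_dir (gplus {i, j}) (true_dir t i j)))"
proof -
  let ?K = "(1 - a) / (a * c\<^sub>w\<^sub>d)"
  have bound: "err (gplus {i, j}) (true_dir t i j) \<le> ?K * exp (- \<beta> * \<Delta>)"
    if ij: "{i, j} \<in> E" for i j
  proof -
    let ?W = "W {i, j}" and ?G = "good_witnesses W R i j" and ?H = "witness_support A0 i j"
    let ?n = "witness_normal g0 i j" and ?g = "gplus {i, j}"
    \<comment> \<open>The competitor of the minimiser: the representative of the true direction in
      the pool, with either sign.\<close>
    obtain c where c: "c \<in> C {i, j}" "same_dir c (true_dir t i j)"
      using D5[OF ij] by blast
    have norm_c: "norm c = 1"
      using c pools[OF ij] by auto
    \<comment> \<open>A witness is an end of an edge, so finiteness is inherited from the vertex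
      set.\<close>
    have "?W \<subseteq> V"
      using witnesses[OF ij] graph unfolding finite_simple_graph_def by blast
    then have fin: "finite ?W"
      using graph finite_subset unfolding finite_simple_graph_def by blast
    have G: "?G \<subseteq> ?W" "?G \<noteq> {}"
      using D2[OF ij] by (auto simp: good_witnesses_def)
    \<comment> \<open>Both edges to a good witness are anchors, hence exact up to sign.\<close>
    have good: "same_dir (?n k) (true_normal t i j k)" if "k \<in> ?G" for k
      using that D1 unfolding witness_normal_def true_normal_def good_witnesses_def
      by (intro same_dir_unit_normal) auto
    have gap: "\<Delta> \<le> ?H k - ?H l" if k: "k \<in> ?G" and l: "l \<in> ?W - ?G" for k l
    proof -
      \<comment> \<open>The witness \<open>l\<close> itself shows that the bad set is nonempty, as
        D4 requires.\<close>
      have l': "l \<in> bad_witnesses W R i j"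
        using l by (simp add: bad_witnesses_def)
      have "Min (?H ` ?G) \<le> ?H k"
        using k fin finite_subset[OF G(1)] by simp
      moreover have "?H l \<le> Max (?H ` bad_witnesses W R i j)"
        using l' fin by (simp add: bad_witnesses_def)
      ultimately show ?thesis
        using D4[OF ij] l' by fastforce
    qed
    have "0 < (\<Sum>l\<in>?W. exp (\<beta> * ?H l))"
      using fin G by (intro sum_pos) auto
    moreover have "sweep_loss \<beta> A0 g0 W i j ?g \<le> sweep_loss \<beta> A0 g0 W i j c"
      using sweep[OF ij] c by (auto simp: is_arg_min_linorder)
    ultimately have le: "(\<Sum>k\<in>?W. exp (\<beta> * ?H k) * \<bar>?g \<bullet> ?n k\<bar>)
        \<le> (\<Sum>k\<in>?W. exp (\<beta> * ?H k) * \<bar>c \<bullet> ?n k\<bar>)"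
      by (simp add: sweep_loss_eq divide_le_cancel)
    show ?thesis
    proof (rule softmax_comparison_bound[OF fin G _ params(1-3) _ gap _ _ _ _ le])
      show "a * real (card ?W) \<le> real (card ?G)"
        using D2[OF ij] by blast
      \<comment> \<open>D3 at \<open>h = gplus {i, j}\<close>; inside absolute values the true
        normals may be replaced by the current ones.\<close>
      show "c\<^sub>w\<^sub>d * err ?g (true_dir t i j) \<le> 1 / real (card ?G) * (\<Sum>k\<in>?G. \<bar>?g \<bullet> ?n k\<bar>)"
        using D3[OF ij, of ?g] by (simp only: err_def same_dir_abs_inner[OF good] cong: sum.cong)
      show "\<bar>c \<bullet> ?n k\<bar> = 0" if "k \<in> ?G" for k
        using same_dir_abs_inner[OF good[OF that], of c] c(2) true_dir_orthogonal_true_normal[of t i j k]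
        by (auto simp: same_dir_def)
      show "\<bar>c \<bullet> ?n k\<bar> \<le> 1" for k
        using Cauchy_Schwarz_ineq2[of c "?n k"] norm_unit_normal_le norm_c
        by (simp add: witness_normal_def) (meson order_trans)
    qed (use sharpness in auto)
  qed
  have recovery: "same_dir (gplus {i, j}) (true_dir t i j)"
    if "?K * exp (- \<beta> * \<Delta>) < \<eta>" "{i, j} \<in> E" for i j
  proof -
    have "gplus {i, j} \<in> C {i, j}"
      using sweep[OF that(2)] by (simp add: is_arg_min_def)
    \<comment> \<open>Any other pool element would have error at least \<open>\<eta>\<close>,
      against the bound.\<close>
    then show ?thesis
      using bound[OF that(2)] D5[OF that(2)] that(1) by fastforce
  qed
  have threshold: "?K * exp (- \<beta> * \<Delta>) < \<eta> \<longleftrightarrow>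
      (1 - a) / (a * c\<^sub>w\<^sub>d * \<eta>) \<le> 1 \<or> \<beta> > 1 / \<Delta> * ln ((1 - a) / (a * c\<^sub>w\<^sub>d * \<eta>))"
    \<comment> \<open>Here \<open>?K\<close> is nonnegative because
      \<open>a \<le> 1\<close>.\<close>
    using sharpness_threshold[of ?K \<eta> \<Delta> \<beta>] params sharpness
    by (simp only: divide_divide_eq_left) simp
  show ?thesis
    using bound recovery threshold by blast
qed

end
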